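(* Let $H$ be a graph of order $n'\ge 2$ and maximum degree $\Delta(H)$, and let $k$ be a positive integer. The graph $K_1+H$ is $k$-metric dimensional if and only if $k=\min\{\mathcal{C}(H),\,n'-\Delta(H)+1\}$.
   Context: All graphs are finite, simple and undirected. $K_1+H$ is the join graph: $H$ together with one new vertex adjacent to every vertex of $H$. For a connected graph $\Gamma$, $d_\Gamma(x,y)$ is the length of a shortest path between $x$ and $y$. For a positive integer $k$, a set $S\subseteq V(\Gamma)$ is a $k$-metric generator for $\Gamma$ if for any two different vertices $u,v$ of $\Gamma$ there are at least $k$ vertices $w\in S$ with $d_\Gamma(u,w)\neq d_\Gamma(v,w)$. A $k$-metric basis is a $k$-metric generator of minimum cardinality. A connected graph is $k'$-metric dimensional if $k'$ is the largest integer for which a $k'$-metric basis exists. For a graph $H$ with at least two vertices, $N_H(x)$ is the open neighborhood of $x$, $\triangledown$ is the symmetric difference of sets, and $$\mathcal{C}(H)=\min_{x,y\in V(H),\,x\ne y}\left|(N_H(x)\triangledown N_H(y))\cup\{x,y\}\right|.$$ *)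

theory Defs
  imports "Graph_Theory.Digraph_Component"
begin

text \<open>
  A finite simple undirected graph is a \<open>pair_graph\<close> of the AFP entry
  \<open>Graph_Theory\<close>: finite, loop-free, and with a symmetric arc relation on the vertex set
  (each edge is represented by both of its orientations).
\<close>

definition nbhd :: "'a pair_pre_digraph \<Rightarrow> 'a \<Rightarrow> 'a set" where
  "nbhd G x = {y \<in> pverts G. (x, y) \<in> parcs G}"

definition max_degree :: "'a pair_pre_digraph \<Rightarrow> nat" where
  "max_degree G = Max {card (nbhd G x) | x. x \<in> pverts G}"

text \<open>
  The join graph \<open>K\<^sub>1 + H\<close>. The new vertex is \<open>None\<close>; the vertices of \<open>H\<close> are embedded by \<open>Some\<close>.
\<close>

definition K1_join :: "'a pair_pre_digraph \<Rightarrow> 'a option pair_pre_digraph" where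
  "K1_join H = \<lparr> pverts = insert None (Some ` pverts H),
     parcs = {(Some x, Some y) | x y. (x, y) \<in> parcs H}
       \<union> {(None, Some x) | x. x \<in> pverts H} \<union> {(Some x, None) | x. x \<in> pverts H} \<rparr>"

lemma pair_graph_K1_join:
  assumes "pair_graph H"
  shows "pair_graph (K1_join H)"
proof -
  interpret pair_graph H by fact
  have fin: "finite (pverts (K1_join H))"
    using pair_finite_verts by (simp add: K1_join_def)
  have sub: "parcs (K1_join H) \<subseteq> pverts (K1_join H) \<times> pverts (K1_join H)"
    by (auto simp: K1_join_def dest: in_arcsD1 in_arcsD2)
  have "finite (parcs (K1_join H))"
    using fin sub by (meson finite_SigmaI finite_subset)
  moreover have "sym (parcs (K1_join H))"
    by (auto simp: K1_join_def sym_def intro: arcs_symmetric)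
  moreover have "fst e \<noteq> snd e" if "e \<in> parcs (K1_join H)" for e
    using that by (auto simp: K1_join_def dest: no_loops')
  ultimately show ?thesis
    using fin sub by unfold_locales (auto simp: symmetric_def)
qed

text \<open>
  Walks are lists of arcs, so \<open>length p\<close> is the number of edges of \<open>p\<close>. The value is
  meaningful only for vertices \<open>x\<close>, \<open>y\<close> joined by a path; below it is used for connected
  graphs only.
\<close>

definition graph_dist :: "'a pair_pre_digraph \<Rightarrow> 'a \<Rightarrow> 'a \<Rightarrow> nat" where
  "graph_dist G x y = (LEAST n. \<exists>p. pre_digraph.apath (with_proj G) x p y \<and> length p = n)"

definition k_metric_generator :: "'a pair_pre_digraph \<Rightarrow> nat \<Rightarrow> 'a set \<Rightarrow> bool" where
  "k_metric_generator G k S \<longleftrightarrow> S \<subseteq> pverts G \<and>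
     (\<forall>u \<in> pverts G. \<forall>v \<in> pverts G. u \<noteq> v \<longrightarrow>
        k \<le> card {w \<in> S. graph_dist G u w \<noteq> graph_dist G v w})"

definition k_metric_basis :: "'a pair_pre_digraph \<Rightarrow> nat \<Rightarrow> 'a set \<Rightarrow> bool" where
  "k_metric_basis G k S \<longleftrightarrow> k_metric_generator G k S \<and>
     (\<forall>T. k_metric_generator G k T \<longrightarrow> card S \<le> card T)"

definition k_metric_dimensional :: "'a pair_pre_digraph \<Rightarrow> nat \<Rightarrow> bool" where
  "k_metric_dimensional G k \<longleftrightarrow> connected (with_proj G) \<and>
     0 < k \<and> (\<exists>S. k_metric_basis G k S) \<and>
     (\<forall>j > 0. (\<exists>S. k_metric_basis G j S) \<longrightarrow> j \<le> k)"

definition C_min :: "'a pair_pre_digraph \<Rightarrow> nat" where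
  "C_min H = Min {card (sym_diff (nbhd H x) (nbhd H y) \<union> {x, y}) | x y.
     x \<in> pverts H \<and> y \<in> pverts H \<and> x \<noteq> y}"

end

theory Submission
  imports Defs
begin

text \<open>
  A set of vertices containing a \<open>k\<close>-metric generator is again one, so a \<open>k\<close>-metric basis exists precisely when
  the whole vertex set is a \<open>k\<close>-metric generator, that is, when every pair of distinct vertices is
  distinguished by at least \<open>k\<close> vertices (\<open>k_metric_basis_exists_iff\<close>). The largest such \<open>k\<close> is
  the least number of vertices that distinguish a pair.

  The join \<open>K\<^sub>1 + H\<close> has diameter at most \<open>2\<close>, because the new vertex is adjacent to all others, so
  a vertex \<open>w\<close> different from \<open>u\<close> and \<open>v\<close> distinguishes them precisely when it is adjacent to exactly
  one of them. For two vertices \<open>x\<close>, \<open>y\<close> of \<open>H\<close> this leaves \<open>x\<close>, \<open>y\<close> and the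
  symmetric difference of their neighbourhoods in \<open>H\<close>, and the minimum over these pairs is
  \<open>\<C>(H)\<close>. The new vertex and a vertex \<open>x\<close> of \<open>H\<close> are distinguished by the new vertex and by
  the vertices of \<open>H\<close> that are not adjacent to \<open>x\<close>, with \<open>x\<close> itself among them; these are
  \<open>n' - deg x + 1\<close> vertices, and the minimum is attained at a vertex of maximum degree.
\<close>

definition distinguishers :: "'a pair_pre_digraph \<Rightarrow> 'a \<Rightarrow> 'a \<Rightarrow> 'a set" where
  "distinguishers G u v = {w \<in> pverts G. graph_dist G u w \<noteq> graph_dist G v w}"

lemma distinguishers_commute: "distinguishers G u v = distinguishers G v u"
  by (auto simp: distinguishers_def)

text \<open>
  Enlarging a set within the vertex set keeps every vertex that distinguishes a given pair, so if
  any \<open>k\<close>-metric generator exists, the set of all vertices is one. Conversely, among the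
  generators one of least cardinality can be chosen.
\<close>

lemma k_metric_basis_exists_iff:
  assumes "finite (pverts G)"
  shows "(\<exists>S. k_metric_basis G k S) \<longleftrightarrow>
    (\<forall>u\<in>pverts G. \<forall>v\<in>pverts G. u \<noteq> v \<longrightarrow> k \<le> card (distinguishers G u v))"
    (is "_ \<longleftrightarrow> ?all")
proof
  assume "\<exists>S. k_metric_basis G k S"
  then obtain S where S: "k_metric_generator G k S"
    by (auto simp: k_metric_basis_def)
  show ?all
  proof (intro ballI impI)
    fix u v assume "u \<in> pverts G" "v \<in> pverts G" "u \<noteq> v"
    with S have "k \<le> card {w \<in> S. graph_dist G u w \<noteq> graph_dist G v w}"
      by (auto simp: k_metric_generator_def)
    also have "\<dots> \<le> card (distinguishers G u v)"
      using S assms by (intro card_mono) (auto simp: k_metric_generator_def distinguishers_def)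
    finally show "k \<le> card (distinguishers G u v)" .
  qed
next
  assume ?all
  then have "k_metric_generator G k (pverts G)"
    by (auto simp: k_metric_generator_def distinguishers_def)
  from ex_has_least_nat[of "k_metric_generator G k", where m = card, OF this]
  show "\<exists>S. k_metric_basis G k S"
    by (auto simp: k_metric_basis_def)
qed

lemma graph_dist_diameter_two:
  assumes "pair_wf_digraph G" "u \<in> pverts G"
    and middle: "\<lbrakk>u \<noteq> w; (u, w) \<notin> parcs G\<rbrakk> \<Longrightarrow> \<exists>c. (u, c) \<in> parcs G \<and> (c, w) \<in> parcs G"
  shows "graph_dist G u w = (if u = w then 0 else if (u, w) \<in> parcs G then 1 else 2)"
proof -
  interpret pair_wf_digraph G by fact
  \<comment> \<open>A least length is characterised by one path of that length and the absence of shorter ones,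
      so the paths of length \<open>0\<close> and \<open>1\<close> are described first.\<close>
  have path0: "(\<exists>p. apath u p w \<and> length p = 0) \<longleftrightarrow> u = w"
    using assms(2) by (auto simp: apath_Nil_iff)
  have path1: "(\<exists>p. apath u p w \<and> length p = 1) \<longleftrightarrow> u \<noteq> w \<and> (u, w) \<in> parcs G"
  proof
    assume "\<exists>p. apath u p w \<and> length p = 1"
    then obtain e where "apath u [e] w"
      by (auto simp: length_Suc_conv)
    then show "u \<noteq> w \<and> (u, w) \<in> parcs G"
      by (cases e) (auto simp: apath_simps)
  next
    assume "u \<noteq> w \<and> (u, w) \<in> parcs G"
    then have "apath u [(u, w)] w"
      by (auto simp: apath_simps dest: in_arcsD2)
    then show "\<exists>p. apath u p w \<and> length p = 1"
      by (intro exI[of _ "[(u, w)]"]) simp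
  qed
  have path2: "\<exists>p. apath u p w \<and> length p = 2" if "u \<noteq> w" "(u, w) \<notin> parcs G"
  proof -
    from middle[OF that] obtain c where c: "(u, c) \<in> parcs G" "(c, w) \<in> parcs G"
      by blast
    with that have "c \<noteq> u" "c \<noteq> w" by auto
    with c that have "apath u [(u, c), (c, w)] w"
      by (auto simp: apath_simps dest: in_arcsD2)
    then show ?thesis
      by (intro exI[of _ "[(u, c), (c, w)]"]) simp
  qed
  show ?thesis
  proof (cases "u = w")
    case True
    then show ?thesis
      unfolding graph_dist_def using path0 by (auto intro!: Least_eq_0)
  next
    case ne: False
    show ?thesis
    proof (cases "(u, w) \<in> parcs G")
      case True
      have "graph_dist G u w = 1"
        unfolding graph_dist_def
      proof (rule Least_equality)
        fix n assume "\<exists>p. apath u p w \<and> length p = n"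
        then have "n \<noteq> 0" using path0 ne by metis
        then show "1 \<le> n" by simp
      qed (use path1 ne True in blast)
      then show ?thesis using ne True by simp
    next
      case False
      have "graph_dist G u w = 2"
        unfolding graph_dist_def
      proof (rule Least_equality)
        fix n assume "\<exists>p. apath u p w \<and> length p = n"
        then have "n \<noteq> 0" "n \<noteq> 1" using path0 path1 ne False by metis+
        then show "2 \<le> n" by simp
      qed (use path2 ne False in blast)
      then show ?thesis using ne False by simp
    qed
  qed
qed

lemma pverts_K1_join: "pverts (K1_join H) = insert None (Some ` pverts H)"
  by (simp add: K1_join_def)

lemma arcs_K1_join:
  "(Some x, Some y) \<in> parcs (K1_join H) \<longleftrightarrow> (x, y) \<in> parcs H"
  "(None, Some x) \<in> parcs (K1_join H) \<longleftrightarrow> x \<in> pverts H"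
  "(Some x, None) \<in> parcs (K1_join H) \<longleftrightarrow> x \<in> pverts H"
  "(None, None) \<notin> parcs (K1_join H)"
  by (auto simp: K1_join_def)

lemma connected_K1_join:
  assumes "pair_graph H"
  shows "connected (with_proj (K1_join H))"
proof -
  interpret J: pair_graph "K1_join H"
    using assms by (rule pair_graph_K1_join)
  have to: "u \<rightarrow>\<^sup>*\<^bsub>K1_join H\<^esub> None" and "from": "None \<rightarrow>\<^sup>*\<^bsub>K1_join H\<^esub> u"
    if "u \<in> pverts (K1_join H)" for u
    using that by (cases u; force simp: arcs_K1_join pverts_K1_join)+
  have "strongly_connected (with_proj (K1_join H))"
    using to "from" by (auto simp: strongly_connected_def pverts_K1_join intro: J.reachable_trans)
  then show ?thesis
    by (simp add: connected_def strongly_connected_def J.reachable_mk_symmetric_eq J.sym_arcs)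
qed

lemma graph_dist_K1_join:
  assumes "pair_graph H" "u \<in> pverts (K1_join H)" "w \<in> pverts (K1_join H)"
  shows "graph_dist (K1_join H) u w =
    (if u = w then 0 else if (u, w) \<in> parcs (K1_join H) then 1 else 2)"
proof (rule graph_dist_diameter_two)
  interpret J: pair_graph "K1_join H"
    using assms(1) by (rule pair_graph_K1_join)
  show "pair_wf_digraph (K1_join H)" ..
  assume "u \<noteq> w" "(u, w) \<notin> parcs (K1_join H)"
  then have "(u, None) \<in> parcs (K1_join H) \<and> (None, w) \<in> parcs (K1_join H)"
    using assms(2,3) by (auto simp: pverts_K1_join arcs_K1_join)
  then show "\<exists>c. (u, c) \<in> parcs (K1_join H) \<and> (c, w) \<in> parcs (K1_join H)" ..
qed fact

text \<open>
  The new vertex is missing here, being at distance \<open>1\<close> from both.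
\<close>

lemma distinguishers_K1_join_Some:
  assumes "pair_graph H" "x \<in> pverts H" "y \<in> pverts H" "x \<noteq> y"
  shows "distinguishers (K1_join H) (Some x) (Some y) =
    Some ` (sym_diff (nbhd H x) (nbhd H y) \<union> {x, y})"
  using assms
  by (auto simp: distinguishers_def graph_dist_K1_join pverts_K1_join arcs_K1_join nbhd_def
      split: if_splits)

lemma card_distinguishers_K1_join_Some:
  assumes "pair_graph H" "x \<in> pverts H" "y \<in> pverts H" "x \<noteq> y"
  shows "card (distinguishers (K1_join H) (Some x) (Some y)) =
    card (sym_diff (nbhd H x) (nbhd H y) \<union> {x, y})"
  unfolding distinguishers_K1_join_Some[OF assms] by (rule card_image[OF inj_Some])

text \<open>
  All of \<open>H\<close> is at distance \<open>1\<close> from the new vertex, hence exactly the neighbours of \<open>x\<close> fail to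
  distinguish the two; the vertex \<open>x\<close> itself lies in the difference because there are no loops.
\<close>

lemma distinguishers_K1_join_None:
  assumes "pair_graph H" "x \<in> pverts H"
  shows "distinguishers (K1_join H) None (Some x) = insert None (Some ` (pverts H - nbhd H x))"
proof -
  interpret pair_graph H by fact
  show ?thesis
    using assms
    by (auto simp: distinguishers_def graph_dist_K1_join pverts_K1_join arcs_K1_join nbhd_def
        image_iff dest: no_loops' split: if_splits)
qed

lemma card_distinguishers_K1_join_None:
  assumes "pair_graph H" "x \<in> pverts H"
  shows "card (distinguishers (K1_join H) None (Some x)) =
    card (pverts H) - card (nbhd H x) + 1"
proof -
  interpret pair_graph H by fact
  have "nbhd H x \<subseteq> pverts H" by (auto simp: nbhd_def)
  then show ?thesis
    using assms pair_finite_verts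
    by (simp add: distinguishers_K1_join_None card_image card_Diff_subset finite_subset)
qed

text \<open>
  Truncated subtraction is antitone in its second argument, so the minimum of
  \<open>n - deg x + 1\<close> over all \<open>x\<close> is attained where the degree is largest, whatever \<open>n\<close> is.
\<close>

lemma le_order_minus_max_degree_iff:
  assumes "finite (pverts H)" "pverts H \<noteq> {}"
  shows "j \<le> n - max_degree H + 1 \<longleftrightarrow> (\<forall>x\<in>pverts H. j \<le> n - card (nbhd H x) + 1)"
proof -
  let ?D = "{card (nbhd H x) | x. x \<in> pverts H}"
  have D: "finite ?D" "?D \<noteq> {}" using assms by auto
  have "max_degree H \<in> ?D"
    unfolding max_degree_def using D by (rule Max_in)
  moreover have "card (nbhd H x) \<le> max_degree H" if "x \<in> pverts H" for x
    unfolding max_degree_def using D(1) that by (intro Max_ge) auto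
  ultimately show ?thesis
    by clarsimp (meson Suc_le_mono diff_le_mono2 le_trans)
qed

lemma le_C_min_iff:
  assumes "finite (pverts H)" "card (pverts H) \<ge> 2"
  shows "j \<le> C_min H \<longleftrightarrow> (\<forall>x\<in>pverts H. \<forall>y\<in>pverts H. x \<noteq> y \<longrightarrow>
    j \<le> card (sym_diff (nbhd H x) (nbhd H y) \<union> {x, y}))"
proof -
  let ?c = "\<lambda>x y. card (sym_diff (nbhd H x) (nbhd H y) \<union> {x, y})"
  let ?C = "{?c x y | x y. x \<in> pverts H \<and> y \<in> pverts H \<and> x \<noteq> y}"
  have "?C \<subseteq> (\<lambda>(x, y). ?c x y) ` (pverts H \<times> pverts H)" by auto
  then have "finite ?C"
    by (rule finite_subset) (use assms(1) in simp)
  moreover obtain x y where "x \<in> pverts H" "y \<in> pverts H" "x \<noteq> y"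
    using assms(2) by (auto simp: card_le_Suc_iff numeral_2_eq_2)
  then have "?C \<noteq> {}" by blast
  ultimately show ?thesis
    unfolding C_min_def by (subst Min_ge_iff) blast+
qed

text \<open>
  The two terms of the minimum come from the two kinds of pairs in the join: pairs within \<open>H\<close> and
  pairs that contain the new vertex.
\<close>

lemma k_metric_basis_K1_join_exists_iff:
  assumes "pair_graph H" "card (pverts H) \<ge> 2"
  shows "(\<exists>S. k_metric_basis (K1_join H) j S) \<longleftrightarrow>
    j \<le> min (C_min H) (card (pverts H) - max_degree H + 1)"
proof -
  interpret pair_graph H by fact
  have fin: "finite (pverts H)" and ne: "pverts H \<noteq> {}"
    using assms(2) pair_finite_verts by auto
  have "(\<exists>S. k_metric_basis (K1_join H) j S) \<longleftrightarrow>
      (\<forall>x\<in>pverts H. \<forall>y\<in>pverts H. x \<noteq> y \<longrightarrow>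
        j \<le> card (distinguishers (K1_join H) (Some x) (Some y))) \<and>
      (\<forall>x\<in>pverts H. j \<le> card (distinguishers (K1_join H) None (Some x)))"
    using fin
    by (subst k_metric_basis_exists_iff)
      (auto simp: pverts_K1_join distinguishers_commute[of _ "Some _" None])
  also have "\<dots> \<longleftrightarrow> j \<le> C_min H \<and> j \<le> card (pverts H) - max_degree H + 1"
    unfolding le_C_min_iff[OF fin assms(2)] le_order_minus_max_degree_iff[OF fin ne]
    using assms(1)
    by (simp add: card_distinguishers_K1_join_Some card_distinguishers_K1_join_None
        cong: ball_cong)
  finally show ?thesis by simp
qed

theorem proposition12:
  fixes H :: "'a pair_pre_digraph" and n' k :: nat
  assumes "pair_graph H"
    and "card (pverts H) = n'"
    and "n' \<ge> 2"
    and "k > 0"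
  shows "k_metric_dimensional (K1_join H) k \<longleftrightarrow> k = min (C_min H) (n' - max_degree H + 1)"
proof -
  define m where "m = min (C_min H) (n' - max_degree H + 1)"
  have "k_metric_dimensional (K1_join H) k \<longleftrightarrow> k \<le> m \<and> (\<forall>j>0. j \<le> m \<longrightarrow> j \<le> k)"
    using assms connected_K1_join[OF assms(1)] k_metric_basis_K1_join_exists_iff[of H]
    by (simp add: k_metric_dimensional_def m_def)
  \<comment> \<open>Positivity of \<open>k\<close> makes \<open>m\<close> itself positive and hence an admissible \<open>j\<close>.\<close>
  also have "\<dots> \<longleftrightarrow> k = m"
    using assms(4) by (metis le_antisym order_refl order_less_le_trans)
  finally show ?thesis by (simp add: m_def)
qed

end
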